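(* Let $(X,T)$ be a minimal Cantor system which is self-induced and expansive. Then $(X,T)$ is topologically conjugate to a substitution subshift $(X_\sigma,S)$ for some primitive substitution $\sigma$ on a finite alphabet.
   Context: A minimal Cantor system is a pair $(X,T)$ with $X$ a Cantor set and $T:X\to X$ a homeomorphism all of whose orbits are dense. For a clopen $U\subset X$, the return time is $r_U(x)=\inf\{n>0: T^nx\in U\}$ and the induced map is $T_U:U\to U$, $T_U(x)=T^{r_U(x)}(x)$. $(X,T)$ is self-induced if there is a nonempty clopen proper subset $U\subsetneq X$ such that $(U,T_U)$ is topologically conjugate to $(X,T)$. $T$ is expansive if there is $\delta>0$ such that for all $x\neq y$ there is $n\in\mathbb Z$ with $d(T^nx,T^ny)>\delta$. For a finite alphabet $\mathcal A$, a substitution is a map $\sigma:\mathcal A\to\mathcal A^+$ (nonempty words), extended to words by concatenation; it is primitive if there is $n$ such that every letter $b$ occurs in $\sigma^n(a)$ for all letters $a$, and there is a letter $a$ with $|\sigma^k(a)|\to\infty$. $X_\sigma\subset\mathcal A^{\mathbb Z}$ is the set of sequences every finite subword of which is a subword of some $\sigma^k(a)$, $a\in\mathcal A$, $k\ge 1$; $S$ is the shift $S(x)_i=x_{i+1}$. *)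

theory Defs
  imports "HOL-Analysis.Analysis" "HOL-Library.Sublist"
begin

definition cantor_set :: "'a::metric_space set \<Rightarrow> bool" where
  "cantor_set X \<longleftrightarrow> X \<noteq> {} \<and> compact X \<and> (\<forall>x\<in>X. x islimpt X)
     \<and> (\<forall>x\<in>X. connected_component_set X x = {x})"

definition ipow :: "'a set \<Rightarrow> ('a \<Rightarrow> 'a) \<Rightarrow> int \<Rightarrow> 'a \<Rightarrow> 'a" where
  "ipow X T n x = (if 0 \<le> n then (T ^^ nat n) x else (inv_into X T ^^ nat (- n)) x)"

definition orbit :: "'a set \<Rightarrow> ('a \<Rightarrow> 'a) \<Rightarrow> 'a \<Rightarrow> 'a set" where
  "orbit X T x = range (\<lambda>n. ipow X T n x)"

definition minimal_cantor_system :: "'a::metric_space set \<Rightarrow> ('a \<Rightarrow> 'a) \<Rightarrow> bool" where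
  "minimal_cantor_system X T \<longleftrightarrow> cantor_set X \<and> homeomorphism X X T (inv_into X T)
     \<and> (\<forall>x\<in>X. closure (orbit X T x) \<inter> X = X)"

definition clopen_in :: "'a::topological_space set \<Rightarrow> 'a set \<Rightarrow> bool" where
  "clopen_in X U \<longleftrightarrow> U \<subseteq> X \<and> openin (top_of_set X) U \<and> closedin (top_of_set X) U"

definition return_time :: "('a \<Rightarrow> 'a) \<Rightarrow> 'a set \<Rightarrow> 'a \<Rightarrow> nat" where
  "return_time T U x = (LEAST n. 0 < n \<and> (T ^^ n) x \<in> U)"

definition induced_map :: "('a \<Rightarrow> 'a) \<Rightarrow> 'a set \<Rightarrow> 'a \<Rightarrow> 'a" where
  "induced_map T U x = (T ^^ return_time T U x) x"

definition top_conj :: "'a::topological_space set \<Rightarrow> ('a \<Rightarrow> 'a) \<Rightarrow> 'b::topological_space set \<Rightarrow> ('b \<Rightarrow> 'b) \<Rightarrow> bool" where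
  "top_conj X T Y R \<longleftrightarrow> (\<exists>h g. homeomorphism X Y h g \<and> (\<forall>x\<in>X. h (T x) = R (h x)))"

definition self_induced :: "'a::metric_space set \<Rightarrow> ('a \<Rightarrow> 'a) \<Rightarrow> bool" where
  "self_induced X T \<longleftrightarrow> (\<exists>U. U \<noteq> {} \<and> U \<subset> X \<and> clopen_in X U
       \<and> top_conj U (induced_map T U) X T)"

definition expansive :: "'a::metric_space set \<Rightarrow> ('a \<Rightarrow> 'a) \<Rightarrow> bool" where
  "expansive X T \<longleftrightarrow> (\<exists>\<delta>>0. \<forall>x\<in>X. \<forall>y\<in>X. x \<noteq> y \<longrightarrow>
       (\<exists>n::int. dist (ipow X T n x) (ipow X T n y) > \<delta>))"

definition subst_word :: "('b \<Rightarrow> 'b list) \<Rightarrow> 'b list \<Rightarrow> 'b list" where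
  "subst_word \<sigma> w = concat (map \<sigma> w)"

definition substitution :: "'b set \<Rightarrow> ('b \<Rightarrow> 'b list) \<Rightarrow> bool" where
  "substitution A \<sigma> \<longleftrightarrow> finite A \<and> (\<forall>a\<in>A. \<sigma> a \<noteq> [] \<and> set (\<sigma> a) \<subseteq> A)"

definition primitive_subst :: "'b set \<Rightarrow> ('b \<Rightarrow> 'b list) \<Rightarrow> bool" where
  "primitive_subst A \<sigma> \<longleftrightarrow> substitution A \<sigma>
     \<and> (\<exists>n. \<forall>a\<in>A. \<forall>b\<in>A. b \<in> set ((subst_word \<sigma> ^^ n) [a]))
     \<and> (\<exists>a\<in>A. filterlim (\<lambda>k. length ((subst_word \<sigma> ^^ k) [a])) at_top sequentially)"

definition factor_of :: "(int \<Rightarrow> 'b) \<Rightarrow> int \<Rightarrow> nat \<Rightarrow> 'b list" where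
  "factor_of x i n = map (\<lambda>j. x (i + int j)) [0..<n]"

definition subst_shift :: "'b set \<Rightarrow> ('b \<Rightarrow> 'b list) \<Rightarrow> (int \<Rightarrow> 'b) set" where
  "subst_shift A \<sigma> = {x. (\<forall>i. x i \<in> A) \<and>
     (\<forall>i n. \<exists>a\<in>A. \<exists>k\<ge>1. sublist (factor_of x i n) ((subst_word \<sigma> ^^ k) [a]))}"

definition shift :: "(int \<Rightarrow> 'b) \<Rightarrow> int \<Rightarrow> 'b" where
  "shift x = (\<lambda>i. x (i + 1))"

end

theory Submission
  imports Defs
begin

text \<open>Inverting the conjugacy gives a continuous \<open>\<phi> : X \<rightarrow> X\<close> and a continuous \<open>r \<ge> 1\<close> with
  \<open>\<phi> (T x) = T\<^bsup>r x\<^esup> (\<phi> x)\<close>, where \<open>r\<close> is the return time; as \<open>U\<close> is proper, \<open>r\<close> is not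
  constantly 1. By minimality, for a suitable iterate of \<open>\<phi>\<close> all long Birkhoff sums of \<open>r\<close> are at
  least twice the number of terms. Replacing \<open>\<phi>\<close> by \<open>T\<^bsup>t x\<^esup> (\<phi> x)\<close> changes \<open>r\<close> by the coboundary
  \<open>t (T x) - t x\<close>, and a suitable \<open>t\<close> achieves \<open>r \<ge> 2\<close> everywhere. Then \<open>\<phi>\<close> expands, so once the
  letters of a generating clopen partition are refined to sufficiently long two-sided windows, the
  letter of \<open>x\<close> determines the word read along \<open>\<phi> x, \<dots>, T\<^bsup>r x - 1\<^esup> (\<phi> x)\<close>. This is the substitution;
  the words of its iterates grow without bound, so minimality makes it primitive and
  identifies its subshift with the coded system.\<close>

section \<open>Maps into discrete spaces\<close>

lemma continuous_on_discrete_iff: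
  fixes f :: "'a::topological_space \<Rightarrow> 'b::discrete_topology"
  shows "continuous_on X f \<longleftrightarrow> (\<forall>v. openin (top_of_set X) {x \<in> X. f x = v})"
proof -
  have "X \<inter> f -` B = (\<Union>v\<in>B. {x \<in> X. f x = v})" for B
    by auto
  moreover have "X \<inter> f -` {v} = {x \<in> X. f x = v}" for v
    by auto
  ultimately show ?thesis
    unfolding continuous_openin_preimage_eq
    by (metis (no_types, lifting) open_discrete openin_Union imageE)
qed

text \<open>The common level sets of the finitely many \<open>g i\<close> are open, and
  \<open>f\<close> is constant on each. Return times, Birkhoff sums and codes all get their
  continuity from this.\<close>

lemma continuous_on_discrete_determined:
  fixes f :: "'a::topological_space \<Rightarrow> 'b::discrete_topology"
    and g :: "'i \<Rightarrow> 'a \<Rightarrow> 'c::discrete_topology"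
  assumes "finite I" and cont: "\<And>i. i \<in> I \<Longrightarrow> continuous_on X (g i)"
    and det: "\<And>x y. x \<in> X \<Longrightarrow> y \<in> X \<Longrightarrow> (\<And>i. i \<in> I \<Longrightarrow> g i x = g i y) \<Longrightarrow> f x = f y"
  shows "continuous_on X f"
  unfolding continuous_on_discrete_iff
proof
  fix v
  define N where "N z = X \<inter> (\<Inter>i\<in>I. {x \<in> X. g i x = g i z})" for z
  have op: "openin (top_of_set X) (N z)" for z
  proof (cases "I = {}")
    case False
    then show ?thesis
      unfolding N_def using \<open>finite I\<close> cont
      by (intro openin_Int openin_INT2) (auto simp: continuous_on_discrete_iff)
  qed (simp add: N_def)
  have "{x \<in> X. f x = v} = \<Union> (N ` {x \<in> X. f x = v})"
  proof
    show "{x \<in> X. f x = v} \<subseteq> \<Union> (N ` {x \<in> X. f x = v})"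
      by (auto simp: N_def)
    show "\<Union> (N ` {x \<in> X. f x = v}) \<subseteq> {x \<in> X. f x = v}"
    proof
      fix x assume "x \<in> \<Union> (N ` {x \<in> X. f x = v})"
      then obtain z where z: "z \<in> X" "f z = v" "x \<in> N z"
        by auto
      then have "f x = f z"
        by (intro det) (auto simp: N_def)
      with z show "x \<in> {x \<in> X. f x = v}"
        by (auto simp: N_def)
    qed
  qed
  then show "openin (top_of_set X) {x \<in> X. f x = v}"
    using op by (metis (no_types, lifting) openin_Union imageE)
qed

text \<open>On each open level set of \<open>k\<close> only one \<open>F v\<close> is involved. This
  covers points such as \<open>P (t x) (\<phi> x)\<close>, where the number of steps varies with
  \<open>x\<close>.\<close>

lemma continuous_on_discrete_parameter:
  fixes k :: "'a::topological_space \<Rightarrow> 'c::discrete_topology"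
    and F :: "'c \<Rightarrow> 'a \<Rightarrow> 'b::topological_space"
  assumes k: "continuous_on X k" and F: "\<And>v. continuous_on X (F v)"
  shows "continuous_on X (\<lambda>x. F (k x) x)"
  unfolding continuous_openin_preimage_eq
proof (intro allI impI)
  fix B :: "'b set" assume "open B"
  have "X \<inter> (\<lambda>x. F (k x) x) -` B = (\<Union>v. {x \<in> X. k x = v} \<inter> (X \<inter> F v -` B))"
    by auto
  moreover have "openin (top_of_set X) ({x \<in> X. k x = v} \<inter> (X \<inter> F v -` B))" for v
  proof (rule openin_Int)
    show "openin (top_of_set X) {x \<in> X. k x = v}"
      using k by (simp add: continuous_on_discrete_iff)
    show "openin (top_of_set X) (X \<inter> F v -` B)"
      using F \<open>open B\<close> by (simp add: continuous_openin_preimage_eq)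
  qed
  ultimately show "openin (top_of_set X) (X \<inter> (\<lambda>x. F (k x) x) -` B)"
    by (metis (no_types, lifting) openin_Union imageE)
qed

lemma continuous_on_clopen_indicator:
  assumes "openin (top_of_set X) U" "closedin (top_of_set X) U"
  shows "continuous_on X (\<lambda>x. x \<in> U)"
  unfolding continuous_on_discrete_iff
proof
  fix v
  have "{x \<in> X. (x \<in> U) = v} = (if v then U else X - U)"
    using openin_imp_subset[OF assms(1)] by auto
  then show "openin (top_of_set X) {x \<in> X. (x \<in> U) = v}"
    using assms by (auto simp: closedin_def)
qed

section \<open>Small clopen partitions\<close>

text \<open>A one-point component is a compact component, so Wilder's theorem splits
  \<open>X\<close> into two disjoint open sets, one of which contains the point and stays inside the
  ball.\<close>

lemma small_clopen_neighbourhood: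
  fixes X :: "'a::metric_space set"
  assumes "compact X" and "x \<in> X" and comp: "connected_component_set X x = {x}" and "e > 0"
  obtains V where "openin (top_of_set X) V" "closedin (top_of_set X) V" "x \<in> V" "V \<subseteq> ball x e"
proof -
  let ?Y = "top_of_set X"
  have "compact_space ?Y"
    using \<open>compact X\<close> by (simp add: compact_space_subtopology)
  have H: "Hausdorff_space ?Y"
    by (simp add: Hausdorff_space_subtopology)
  have "connected_component_of_set ?Y x = {x}"
  proof -
    have "connected_component_of ?Y x y \<longleftrightarrow> connected_component X x y" for y
      by (auto simp: connected_component_of_def connectedin_subtopology connected_component_def)
    with comp show ?thesis by auto
  qed
  then have "{x} \<in> connected_components_of ?Y"
    using \<open>x \<in> X\<close> by (metis connected_component_in_connected_components_of topspace_euclidean_subtopology)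
  moreover have "openin ?Y (X \<inter> ball x e)"
    by (simp add: openin_open_Int)
  moreover have "locally_compact_space ?Y"
    using \<open>compact_space ?Y\<close> by (simp add: compact_imp_locally_compact_space)
  ultimately obtain U V where UV: "openin ?Y U" "openin ?Y V" "disjnt U V" "U \<union> V = topspace ?Y" "{x} \<subseteq> U" "U \<subseteq> X \<inter> ball x e"
    using wilder_locally_compact_component_thm[of ?Y "{x}" "X \<inter> ball x e"] H \<open>x \<in> X\<close> \<open>e > 0\<close>
    by (auto simp: compactin_subtopology)
  then have "U = topspace ?Y - V"
    by (auto simp: disjnt_iff)
  then have "closedin ?Y U"
    using UV by auto
  with UV that show thesis by auto
qed

text \<open>Compactness leaves finitely many clopen sets in balls of radius \<open>e/2\<close>;
  naming a point by the least index of a set containing it turns this cover into a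
  partition.\<close>

lemma small_clopen_partition:
  fixes X :: "'a::metric_space set"
  assumes "compact X" and comp: "\<And>x. x \<in> X \<Longrightarrow> connected_component_set X x = {x}" and "e > 0"
  obtains c :: "'a \<Rightarrow> nat" where "continuous_on X c"
    "\<And>x y. x \<in> X \<Longrightarrow> y \<in> X \<Longrightarrow> c x = c y \<Longrightarrow> dist x y < e"
proof -
  have "\<exists>V. openin (top_of_set X) V \<and> closedin (top_of_set X) V \<and> x \<in> V \<and> V \<subseteq> ball x (e/2)" if "x \<in> X" for x
    using small_clopen_neighbourhood[OF \<open>compact X\<close> that comp[OF that], of "e/2"] \<open>e > 0\<close> by (metis half_gt_zero)
  then obtain V where V: "\<And>x. x \<in> X \<Longrightarrow> openin (top_of_set X) (V x)"
      "\<And>x. x \<in> X \<Longrightarrow> closedin (top_of_set X) (V x)" "\<And>x. x \<in> X \<Longrightarrow> x \<in> V x"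
      "\<And>x. x \<in> X \<Longrightarrow> V x \<subseteq> ball x (e/2)"
    by metis
  have "\<exists>D\<subseteq>V ` X. finite D \<and> X \<subseteq> \<Union>D"
  proof -
    have "\<forall>W\<in>V ` X. openin (top_of_set X) W" "X \<subseteq> \<Union>(V ` X)"
      using V by auto
    then show ?thesis
      using \<open>compact X\<close> unfolding compact_eq_openin_cover by presburger
  qed
  then obtain F where F: "F \<subseteq> X" "finite F" "X \<subseteq> \<Union>(V ` F)"
    by (metis finite_subset_image)
  obtain p :: "nat \<Rightarrow> 'a" and n where p: "F = p ` {..<n}"
    using finite_imp_nat_seg_image_inj_on[OF F(2)] by (auto simp: lessThan_def)
  have pX: "p i \<in> X" if "i < n" for i
    using p F that by auto
  define c where "c x = (LEAST i. i < n \<and> x \<in> V (p i))" for x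
  have ex: "\<exists>i. i < n \<and> x \<in> V (p i)" if "x \<in> X" for x
    using F p that by auto
  have c: "c x < n \<and> x \<in> V (p (c x))" if "x \<in> X" for x
    unfolding c_def using ex[OF that] by (rule LeastI_ex)
  show thesis
  proof
    show "continuous_on X c"
    proof (rule continuous_on_discrete_determined[where I = "{..<n}" and g = "\<lambda>i x. x \<in> V (p i)"])
      show "continuous_on X (\<lambda>x. x \<in> V (p i))" if "i \<in> {..<n}" for i
        using that V pX by (intro continuous_on_clopen_indicator) auto
      show "c x = c y" if "\<And>i. i \<in> {..<n} \<Longrightarrow> (x \<in> V (p i)) = (y \<in> V (p i))" for x y
        unfolding c_def using that by (metis lessThan_iff)
    qed simp
    show "dist x y < e" if "x \<in> X" "y \<in> X" "c x = c y" for x y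
    proof -
      have "dist (p (c x)) x < e/2" "dist (p (c x)) y < e/2"
        using c[OF that(1)] c[OF that(2)] that(3) V(4) pX by (auto simp: subset_iff)
      then show ?thesis
        by (metis dist_triangle_half_r)
    qed
  qed
qed

section \<open>Minimal homeomorphisms of compact spaces\<close>

locale minimal_homeomorphism =
  fixes X :: "'a::metric_space set" and T :: "'a \<Rightarrow> 'a"
  assumes compact: "compact X" and nonempty: "X \<noteq> {}"
    and homeo: "homeomorphism X X T (inv_into X T)"
    and dense: "\<And>x. x \<in> X \<Longrightarrow> X \<subseteq> closure (orbit X T x)"
begin

abbreviation P :: "int \<Rightarrow> 'a \<Rightarrow> 'a" where
  "P \<equiv> ipow X T"

lemma T_in: "x \<in> X \<Longrightarrow> T x \<in> X"
  using homeo by (auto simp: homeomorphism_def)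

lemma inv_T_in: "x \<in> X \<Longrightarrow> inv_into X T x \<in> X"
  using homeo by (auto simp: homeomorphism_def)

lemma T_inv: "x \<in> X \<Longrightarrow> T (inv_into X T x) = x"
  using homeo by (auto simp: homeomorphism_def)

lemma inv_T: "x \<in> X \<Longrightarrow> inv_into X T (T x) = x"
  using homeo by (auto simp: homeomorphism_def)

lemma funpow_in: "x \<in> X \<Longrightarrow> (T ^^ n) x \<in> X"
  by (induction n) (auto intro: T_in)

lemma continuous_on_funpow:
  assumes "continuous_on X f" "f ` X \<subseteq> X"
  shows "continuous_on X (f ^^ n) \<and> (f ^^ n) ` X \<subseteq> X"
proof (induction n)
  case (Suc n)
  then have "continuous_on X (f \<circ> f ^^ n)"
    by (intro continuous_on_compose) (auto intro: continuous_on_subset assms)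
  with Suc assms show ?case
    by (auto simp: image_subset_iff)
qed simp

lemma P_in: "x \<in> X \<Longrightarrow> P n x \<in> X"
  using continuous_on_funpow[of T "nat n"] continuous_on_funpow[of "inv_into X T" "nat (- n)"] homeo
  by (auto simp: homeomorphism_def ipow_def)

lemma continuous_on_P: "continuous_on X (P n)"
proof -
  have "continuous_on X (T ^^ nat n)" "continuous_on X (inv_into X T ^^ nat (- n))"
    using continuous_on_funpow[of T] continuous_on_funpow[of "inv_into X T"] homeo
    by (auto simp: homeomorphism_def)
  then show ?thesis
    by (cases "0 \<le> n") (simp_all add: ipow_def[abs_def])
qed

lemma P_nat: "P (int n) x = (T ^^ n) x"
  by (simp add: ipow_def)

lemma P_0 [simp]: "P 0 x = x"
  by (simp add: ipow_def)

text \<open>Only negative \<open>n\<close> needs an argument: there \<open>T\<close> cancels the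
  outermost inverse, because the remaining iterate lies in \<open>X\<close>.\<close>

lemma P_Suc:
  assumes "x \<in> X"
  shows "P (n + 1) x = T (P n x)"
proof (cases "0 \<le> n")
  case True
  then show ?thesis by (simp add: ipow_def nat_add_distrib)
next
  case False
  define m where "m = nat (- n - 1)"
  with False have n: "n = - int m - 1" by auto
  have "(inv_into X T ^^ m) x \<in> X"
    using assms by (induction m) (auto intro: inv_T_in)
  then have "T (P n x) = (inv_into X T ^^ m) x"
    by (simp add: n ipow_def nat_add_distrib T_inv)
  also have "\<dots> = P (n + 1) x"
    by (cases "m = 0") (auto simp: n ipow_def)
  finally show ?thesis by simp
qed

lemma P_pred:
  assumes "x \<in> X"
  shows "P (n - 1) x = inv_into X T (P n x)"
  using P_Suc[OF assms, of "n - 1"] inv_T[OF P_in[OF assms]] by simp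

lemma P_add:
  assumes "x \<in> X"
  shows "P (m + n) x = P m (P n x)"
proof (induction m rule: int_induct[where k = 0])
  case (step1 i)
  then show ?case
    using P_Suc[OF assms, of "i + n"] P_Suc[OF P_in[OF assms], of i n] by (simp add: algebra_simps)
next
  case (step2 i)
  then show ?case
    using P_pred[OF assms, of "i + n"] P_pred[OF P_in[OF assms], of i n] by (simp add: algebra_simps)
qed simp

lemma P_funpow: "x \<in> X \<Longrightarrow> P n ((T ^^ k) x) = P (n + int k) x"
  using P_add[of x n "int k"] by (simp add: P_nat)

lemma P_minus: "x \<in> X \<Longrightarrow> P n (P (- n) x) = x"
  using P_add[of x n "- n"] by simp

text \<open>Density of orbits makes the open sets \<open>W n\<close> cover \<open>X\<close>, and
  compactness leaves finitely many times. Some of these may be negative; a common shift makes them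
  positive.\<close>

lemma uniform_visits:
  assumes "openin (top_of_set X) V" "V \<noteq> {}"
  obtains N where "\<And>x. x \<in> X \<Longrightarrow> \<exists>i\<in>{1..N}. (T ^^ i) x \<in> V"
proof -
  define W where "W n = X \<inter> P n -` V" for n
  have "openin (top_of_set X) (W n)" for n
    unfolding W_def
    using continuous_on_P P_in assms(1) by (intro continuous_openin_preimage[where T = X]) auto
  moreover have "X \<subseteq> (\<Union>n. W n)"
  proof
    fix x assume "x \<in> X"
    obtain B where B: "open B" "V = X \<inter> B"
      using assms(1) by (auto simp: openin_open)
    obtain v where "v \<in> V" using assms by auto
    then have "v \<in> closure (orbit X T x)" "v \<in> B"
      using dense[OF \<open>x \<in> X\<close>] B by auto
    then have "orbit X T x \<inter> B \<noteq> {}"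
      using \<open>open B\<close> open_Int_closure_eq_empty by blast
    then show "x \<in> (\<Union>n. W n)"
      using B P_in \<open>x \<in> X\<close> by (auto simp: orbit_def W_def)
  qed
  ultimately have "\<exists>D\<subseteq>range W. finite D \<and> X \<subseteq> \<Union>D"
    using compact unfolding compact_eq_openin_cover by (metis imageE)
  then obtain I where I: "finite I" "X \<subseteq> \<Union>(W ` I)"
    by (metis finite_subset_image)
  have M: "\<bar>i\<bar> \<le> (\<Sum>i\<in>I. \<bar>i\<bar>)" if "i \<in> I" for i
    using that I(1) by (intro member_le_sum) auto
  define M where "M = (\<Sum>i\<in>I. \<bar>i\<bar>)"
  note M = M[folded M_def]
  show thesis
  proof
    fix x assume "x \<in> X"
    \<comment> \<open>Times are counted from the point \<open>M + 1\<close> steps ahead, so that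
      \<open>i + M + 1\<close> lies in \<open>{1..2 * M + 1}\<close>.\<close>
    then obtain i where i: "i \<in> I" "P i (P (M + 1) x) \<in> V"
      using I P_in[OF \<open>x \<in> X\<close>, of "M + 1"] by (auto simp: W_def)
    have "P (int (nat (i + M + 1))) x \<in> V"
      using i M[OF i(1)] P_add[OF \<open>x \<in> X\<close>, of i "M + 1"] by (simp add: algebra_simps)
    then have "(T ^^ nat (i + M + 1)) x \<in> V"
      by (simp only: P_nat)
    then show "\<exists>i\<in>{1..nat (2 * M + 1)}. (T ^^ i) x \<in> V"
      using M[OF i(1)] by (intro bexI[of _ "nat (i + M + 1)"]) auto
  qed
qed

end

section \<open>Birkhoff sums and itineraries\<close>

definition birkhoff :: "('a \<Rightarrow> 'a) \<Rightarrow> ('a \<Rightarrow> nat) \<Rightarrow> nat \<Rightarrow> 'a \<Rightarrow> nat" where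
  "birkhoff T r n x = (\<Sum>i<n. r ((T ^^ i) x))"

lemma birkhoff_0 [simp]: "birkhoff T r 0 x = 0"
  by (simp add: birkhoff_def)

lemma birkhoff_1 [simp]: "birkhoff T r (Suc 0) x = r x"
  by (simp add: birkhoff_def)

lemma birkhoff_Suc: "birkhoff T r (Suc n) x = birkhoff T r n x + r ((T ^^ n) x)"
  by (simp add: birkhoff_def)

text \<open>The cocycle identity over \<open>T\<close>, by which sums are cut into blocks.\<close>

lemma birkhoff_add: "birkhoff T r (m + n) x = birkhoff T r m x + birkhoff T r n ((T ^^ m) x)"
proof (induction n)
  case (Suc n)
  have "(T ^^ n) ((T ^^ m) x) = (T ^^ (m + n)) x"
    by (metis add.commute comp_apply funpow_add)
  with Suc show ?case by (simp add: birkhoff_Suc)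
qed simp

definition itinerary :: "('a \<Rightarrow> 'a) \<Rightarrow> ('a \<Rightarrow> 'b) \<Rightarrow> nat \<Rightarrow> 'a \<Rightarrow> 'b list" where
  "itinerary T c n x = map (\<lambda>i. c ((T ^^ i) x)) [0..<n]"

lemma length_itinerary [simp]: "length (itinerary T c n x) = n"
  by (simp add: itinerary_def)

lemma nth_itinerary: "i < n \<Longrightarrow> itinerary T c n x ! i = c ((T ^^ i) x)"
  by (simp add: itinerary_def)

lemma itinerary_eq_iff:
  "itinerary T c m x = itinerary T c n y \<longleftrightarrow> m = n \<and> (\<forall>i<m. c ((T ^^ i) x) = c ((T ^^ i) y))"
  by (auto simp: list_eq_iff_nth_eq nth_itinerary)

lemma itinerary_add:
  "itinerary T c (m + n) x = itinerary T c m x @ itinerary T c n ((T ^^ m) x)"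
proof (rule nth_equalityI)
  fix i assume "i < length (itinerary T c (m + n) x)"
  moreover have "(T ^^ (i - m)) ((T ^^ m) x) = (T ^^ i) x" if "m \<le> i"
    using that by (metis comp_apply funpow_add le_add_diff_inverse2)
  ultimately show "itinerary T c (m + n) x ! i = (itinerary T c m x @ itinerary T c n ((T ^^ m) x)) ! i"
    by (auto simp: nth_append nth_itinerary)
qed simp

lemma itinerary_1 [simp]: "itinerary T c (Suc 0) x = [c x]"
  by (simp add: itinerary_def)

lemma sublist_itinerary:
  assumes "i + n \<le> m"
  shows "sublist (itinerary T c n ((T ^^ i) x)) (itinerary T c m x)"
proof -
  obtain q where "m = i + (n + q)"
    using assms by (metis add.assoc le_Suc_ex)
  then show ?thesis
    by (auto simp: itinerary_add sublist_def)
qed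

lemma sublist_itineraryD:
  assumes "sublist w (itinerary T c m x)"
  obtains i where "w = itinerary T c (length w) ((T ^^ i) x)"
proof -
  obtain u v where uv: "itinerary T c m x = u @ w @ v"
    using assms by (auto simp: sublist_def)
  then have "m = length u + (length w + length v)"
    by (metis length_append length_itinerary)
  with uv have "w = itinerary T c (length w) ((T ^^ length u) x)"
    by (simp add: itinerary_add)
  with that show thesis .
qed

lemma subst_word_append: "subst_word \<sigma> (u @ v) = subst_word \<sigma> u @ subst_word \<sigma> v"
  by (simp add: subst_word_def)

section \<open>Orbit morphisms, their composition and their growth\<close>

context minimal_homeomorphism
begin

lemma continuous_on_comp_funpow:
  assumes "continuous_on X f"
  shows "continuous_on X (\<lambda>x. f ((T ^^ n) x))"
proof -
  have "continuous_on X (T ^^ n)"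
    using continuous_on_P[of "int n"] by (simp add: P_nat[abs_def])
  then show ?thesis
    using assms funpow_in by (intro continuous_on_compose2[where f = "T ^^ n" and g = f]) auto
qed

lemma continuous_on_comp_P:
  assumes "continuous_on X f"
  shows "continuous_on X (\<lambda>x. f (P n x))"
  using assms P_in continuous_on_P
  by (intro continuous_on_compose2[where f = "P n" and g = f]) auto

lemma continuous_on_birkhoff:
  assumes "continuous_on X r"
  shows "continuous_on X (birkhoff T r n)"
proof (rule continuous_on_discrete_determined[where I = "{..<n}" and g = "\<lambda>i x. r ((T ^^ i) x)"])
  show "continuous_on X (\<lambda>x. r ((T ^^ i) x))" for i
    using assms by (rule continuous_on_comp_funpow)
qed (auto simp: birkhoff_def)

text \<open>\<open>to_nat\<close> encodes words injectively, so that a word becomes a value in a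
  discrete space.\<close>

lemma continuous_on_itinerary_code:
  fixes c :: "'a \<Rightarrow> nat"
  assumes "continuous_on X c"
  shows "continuous_on X (\<lambda>x. to_nat (itinerary T c n x))"
proof (rule continuous_on_discrete_determined[where I = "{..<n}" and g = "\<lambda>i x. c ((T ^^ i) x)"])
  show "continuous_on X (\<lambda>x. c ((T ^^ i) x))" for i
    using assms by (rule continuous_on_comp_funpow)
qed (auto simp: itinerary_eq_iff)

text \<open>The time function \<open>r\<close> is carried along as data, since composition and
  coboundary changes are computed on it.\<close>

definition orbit_morphism :: "('a \<Rightarrow> 'a) \<Rightarrow> ('a \<Rightarrow> nat) \<Rightarrow> bool" where
  "orbit_morphism \<phi> r \<longleftrightarrow> \<phi> ` X \<subseteq> X \<and> continuous_on X \<phi> \<and> continuous_on X r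
     \<and> (\<forall>x\<in>X. \<phi> (T x) = (T ^^ r x) (\<phi> x))"

lemma orbit_morphism_in: "orbit_morphism \<phi> r \<Longrightarrow> x \<in> X \<Longrightarrow> \<phi> x \<in> X"
  by (auto simp: orbit_morphism_def)

lemma orbit_morphism_funpow:
  assumes "orbit_morphism \<phi> r" "x \<in> X"
  shows "\<phi> ((T ^^ n) x) = (T ^^ birkhoff T r n x) (\<phi> x)"
proof (induction n)
  case (Suc n)
  have "\<phi> ((T ^^ Suc n) x) = (T ^^ r ((T ^^ n) x)) (\<phi> ((T ^^ n) x))"
    using assms funpow_in by (simp add: orbit_morphism_def)
  also have "\<dots> = (T ^^ birkhoff T r (Suc n) x) (\<phi> x)"
    unfolding Suc birkhoff_Suc add.commute[of "birkhoff T r n x"] funpow_add by simp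
  finally show ?case .
qed simp

text \<open>The first \<open>n\<close> steps from \<open>x\<close> become
  \<open>birkhoff T r n x\<close> steps from \<open>\<phi> x\<close>, laid out in consecutive
  blocks; summing \<open>s\<close> block by block is summing it over all of them.\<close>

lemma birkhoff_comp:
  assumes "orbit_morphism \<phi> r" "x \<in> X"
  shows "birkhoff T (\<lambda>x. birkhoff T s (r x) (\<phi> x)) n x = birkhoff T s (birkhoff T r n x) (\<phi> x)"
proof (induction n)
  case (Suc n)
  then show ?case
    by (simp add: birkhoff_Suc birkhoff_add orbit_morphism_funpow[OF assms])
qed simp

text \<open>One step from \<open>x\<close> becomes \<open>r x\<close> steps from
  \<open>\<phi> x\<close>, and \<open>\<psi>\<close> turns these into a Birkhoff sum of
  \<open>s\<close>.\<close>

lemma orbit_morphism_comp: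
  assumes \<phi>: "orbit_morphism \<phi> r" and \<psi>: "orbit_morphism \<psi> s"
  shows "orbit_morphism (\<lambda>x. \<psi> (\<phi> x)) (\<lambda>x. birkhoff T s (r x) (\<phi> x))"
  unfolding orbit_morphism_def
proof (intro conjI ballI)
  have c: "continuous_on X \<phi>" "\<phi> ` X \<subseteq> X"
    using \<phi> by (auto simp: orbit_morphism_def)
  show "continuous_on X (\<lambda>x. \<psi> (\<phi> x))"
    using \<psi> c by (intro continuous_on_compose2[where f = \<phi> and g = \<psi>]) (auto simp: orbit_morphism_def)
  show "continuous_on X (\<lambda>x. birkhoff T s (r x) (\<phi> x))"
  proof (rule continuous_on_discrete_parameter[where k = r and F = "\<lambda>v x. birkhoff T s v (\<phi> x)"])
    show "continuous_on X r"
      using \<phi> by (simp add: orbit_morphism_def)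
    show "continuous_on X (\<lambda>x. birkhoff T s v (\<phi> x))" for v
      using \<psi> c continuous_on_birkhoff
      by (intro continuous_on_compose2[where f = \<phi> and g = "birkhoff T s v"]) (auto simp: orbit_morphism_def)
  qed
  show "(\<lambda>x. \<psi> (\<phi> x)) ` X \<subseteq> X"
    using \<phi> \<psi> by (auto simp: orbit_morphism_def)
  fix x assume "x \<in> X"
  then have "\<phi> (T x) = (T ^^ r x) (\<phi> x)" "\<phi> x \<in> X"
    using \<phi> by (auto simp: orbit_morphism_def)
  then show "\<psi> (\<phi> (T x)) = (T ^^ birkhoff T s (r x) (\<phi> x)) (\<psi> (\<phi> x))"
    using orbit_morphism_funpow[OF \<psi>] by simp
qed

text \<open>Cut the \<open>n\<close> steps into \<open>n div K\<close> blocks of length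
  \<open>K\<close> and a remainder: each block contributes at least one more than its length, the
  remainder at least its length.\<close>

lemma birkhoff_lower_bound:
  assumes pos: "\<And>x. x \<in> X \<Longrightarrow> 1 \<le> r x" and K: "\<And>x. x \<in> X \<Longrightarrow> K + 1 \<le> birkhoff T r K x"
    and "x \<in> X"
  shows "n + n div K \<le> birkhoff T r n x"
proof -
  have 1: "m \<le> birkhoff T r m y" if "y \<in> X" for m y
  proof (induction m)
    case (Suc m)
    with pos[OF funpow_in[OF that]] show ?case
      by (metis Suc_eq_plus1 add_mono birkhoff_Suc)
  qed simp
  have 2: "q * K + q \<le> birkhoff T r (q * K) y" if "y \<in> X" for q y
    using that
  proof (induction q arbitrary: y)
    case (Suc q)
    have "birkhoff T r (Suc q * K) y = birkhoff T r K y + birkhoff T r (q * K) ((T ^^ K) y)"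
      by (simp add: birkhoff_add)
    with Suc.IH[OF funpow_in[OF Suc.prems], of K] K[OF Suc.prems] show ?case
      by simp
  qed simp
  let ?q = "n div K"
  have "birkhoff T r n x = birkhoff T r (?q * K + n mod K) x"
    by simp
  also have "\<dots> = birkhoff T r (?q * K) x + birkhoff T r (n mod K) ((T ^^ (?q * K)) x)"
    by (rule birkhoff_add)
  also have "\<dots> \<ge> (?q * K + ?q) + n mod K"
    using 2[OF \<open>x \<in> X\<close>] 1[OF funpow_in[OF \<open>x \<in> X\<close>]] by (intro add_mono) auto
  finally show ?thesis
    using div_mult_mod_eq[of n K] by linarith
qed

text \<open>\<open>\<psi>\<close> is the \<open>l\<close>-fold composite of \<open>\<phi>\<close>.
  One more composition turns a sum \<open>m \<ge> n\<close> into at least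
  \<open>m + m div K\<close>, so it gains another \<open>n div K\<close>.\<close>

lemma orbit_morphism_iterate:
  assumes \<phi>: "orbit_morphism \<phi> r" and bd: "\<And>x n. x \<in> X \<Longrightarrow> n + n div K \<le> birkhoff T r n x"
  shows "\<exists>\<psi> s. orbit_morphism \<psi> s \<and> (\<forall>x\<in>X. \<forall>n. n + l * (n div K) \<le> birkhoff T s n x)"
proof (induction l)
  case 0
  have "orbit_morphism (\<lambda>x. x) (\<lambda>x. 1)"
    using T_in by (auto simp: orbit_morphism_def)
  moreover have "birkhoff T (\<lambda>x. 1) n x = n" for n x
    by (simp add: birkhoff_def)
  ultimately show ?case
    by (metis add.right_neutral mult_0 order_refl)
next
  case (Suc l)
  then obtain \<psi> s where \<psi>: "orbit_morphism \<psi> s"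
    and s: "\<And>x n. x \<in> X \<Longrightarrow> n + l * (n div K) \<le> birkhoff T s n x"
    by blast
  have "n + Suc l * (n div K) \<le> birkhoff T r (birkhoff T s n x) (\<psi> x)" if "x \<in> X" for x n
  proof -
    let ?m = "birkhoff T s n x"
    have "n \<le> ?m" "n + l * (n div K) \<le> ?m"
      using s[OF that, of n] by auto
    then have "n + Suc l * (n div K) \<le> ?m + ?m div K"
      using div_le_mono[of n ?m K] by simp
    also have "\<dots> \<le> birkhoff T r ?m (\<psi> x)"
      using bd orbit_morphism_in[OF \<psi> that] .
    finally show ?thesis .
  qed
  then have "\<forall>x\<in>X. \<forall>n. n + Suc l * (n div K) \<le> birkhoff T (\<lambda>x. birkhoff T r (s x) (\<psi> x)) n x"
    using birkhoff_comp[OF \<psi>] by simp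
  with orbit_morphism_comp[OF \<psi> \<phi>] show ?case
    by (intro exI conjI)
qed

text \<open>Adding the coboundary of the minimum \<open>t\<close> of the Birkhoff sums of \<open>r - 2\<close> makes
  this function nonnegative everywhere.\<close>

lemma orbit_morphism_regularize:
  assumes \<phi>: "orbit_morphism \<phi> r" and J: "\<And>x n. x \<in> X \<Longrightarrow> J \<le> n \<Longrightarrow> 2 * n \<le> birkhoff T r n x"
  shows "\<exists>\<psi> s. orbit_morphism \<psi> s \<and> (\<forall>x\<in>X. 2 \<le> s x)"
proof -
  define d where "d n x = int (birkhoff T r n x) - 2 * int n" for n x
  \<comment> \<open>For \<open>n \<ge> J\<close> the values \<open>d n x\<close> are nonnegative,
    while \<open>d 0 x = 0\<close>; so this is the minimum over all \<open>n\<close>, and its finite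
    range keeps \<open>t\<close> locally constant.\<close>
  define t where "t x = Min ((\<lambda>n. d n x) ` {..J})" for x
  \<comment> \<open>The truncation by \<open>nat\<close> loses nothing, since \<open>ge\<close>
    below bounds the integer from below by 2.\<close>
  define s where "s x = nat (int (r x) + t (T x) - t x)" for x
  define \<psi> where "\<psi> x = P (t x) (\<phi> x)" for x
  have r: "continuous_on X r" "continuous_on X \<phi>" "\<And>x. x \<in> X \<Longrightarrow> \<phi> x \<in> X"
      "\<And>x. x \<in> X \<Longrightarrow> \<phi> (T x) = (T ^^ r x) (\<phi> x)"
    using \<phi> by (auto simp: orbit_morphism_def)
  have t: "continuous_on X t"
  proof (rule continuous_on_discrete_determined[where I = "{..J}" and g = "birkhoff T r"])
    show "continuous_on X (birkhoff T r n)" for n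
      using r(1) by (rule continuous_on_birkhoff)
    show "t x = t y" if "\<And>n. n \<in> {..J} \<Longrightarrow> birkhoff T r n x = birkhoff T r n y" for x y
      unfolding t_def d_def using that by (intro arg_cong[where f = Min] image_cong) auto
  qed simp
  have d0: "t x \<le> 0" for x
    unfolding t_def by (intro Min_le) (auto simp: image_iff d_def intro!: bexI[of _ 0])
  have t_le: "t x \<le> d n x" if "x \<in> X" for n x
  proof (cases "n \<le> J")
    case True
    then show ?thesis unfolding t_def by (intro Min_le) auto
  next
    case False
    then have "0 \<le> d n x" using J[OF that, of n] by (simp add: d_def)
    with d0[of x] show ?thesis by simp
  qed
  \<comment> \<open>If the minimum at \<open>T x\<close> is attained at \<open>n\<close>, prepending
    the step from \<open>x\<close> gives \<open>d (Suc n) x = r x - 2 + d n (T x)\<close>, which is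
    at least the minimum at \<open>x\<close>.\<close>
  have ge: "2 \<le> int (r x) + t (T x) - t x" if "x \<in> X" for x
  proof -
    have "t (T x) \<in> (\<lambda>n. d n (T x)) ` {..J}"
      unfolding t_def by (intro Min_in) auto
    then obtain n where n: "t (T x) = d n (T x)"
      by auto
    have "birkhoff T r (Suc n) x = r x + birkhoff T r n (T x)"
      using birkhoff_add[of T r 1 n x] by simp
    then have "d (Suc n) x = int (r x) + d n (T x) - 2"
      by (simp add: d_def)
    with t_le[OF that, of "Suc n"] n show ?thesis by simp
  qed
  have "orbit_morphism \<psi> s"
    unfolding orbit_morphism_def
  proof (intro conjI ballI)
    show "\<psi> ` X \<subseteq> X"
      using P_in r(3) by (auto simp: \<psi>_def)
    show "continuous_on X \<psi>"
      unfolding \<psi>_def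
    proof (rule continuous_on_discrete_parameter[OF t])
      show "continuous_on X (\<lambda>x. P v (\<phi> x))" for v
        using continuous_on_P r by (intro continuous_on_compose2[where f = \<phi> and g = "P v"]) auto
    qed
    have tT: "continuous_on X (\<lambda>x. t (T x))"
      using continuous_on_comp_funpow[OF t, of 1] by simp
    show "continuous_on X s"
      unfolding s_def
    proof (rule continuous_on_discrete_parameter[OF t], rule continuous_on_discrete_parameter[OF tT])
      show "continuous_on X (\<lambda>x. nat (int (r x) + v - w))" for v w
        by (rule continuous_on_discrete_determined[where I = "{()}" and g = "\<lambda>_. r"]) (auto intro: r)
    qed
    fix x assume x: "x \<in> X"
    have "\<psi> (T x) = P (t (T x)) (P (int (r x)) (\<phi> x))"
      using r(4)[OF x] by (simp add: \<psi>_def P_nat)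
    also have "\<dots> = P (int (s x) + t x) (\<phi> x)"
      using P_add[OF r(3)[OF x], of "t (T x)" "int (r x)"] ge[OF x] by (simp add: s_def algebra_simps)
    also have "\<dots> = (T ^^ s x) (\<psi> x)"
      using P_add[OF r(3)[OF x]] by (simp add: \<psi>_def P_nat)
    finally show "\<psi> (T x) = (T ^^ s x) (\<psi> x)" .
  qed
  moreover have "2 \<le> s x" if "x \<in> X" for x
    using ge[OF that] by (simp add: s_def)
  ultimately show ?thesis by blast
qed

text \<open>The level set of \<open>r\<close> through \<open>x0\<close> is open and
  \<open>r > 1\<close> on it. Every orbit visits it within bounded time, so all windows of a fixed
  length gain at least one; iterating amplifies this gain until regularization applies.\<close>

lemma orbit_morphism_doubling:
  assumes \<phi>: "orbit_morphism \<phi> r" and pos: "\<And>x. x \<in> X \<Longrightarrow> 1 \<le> r x"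
    and "x0 \<in> X" "r x0 \<noteq> 1"
  shows "\<exists>\<psi> s. orbit_morphism \<psi> s \<and> (\<forall>x\<in>X. 2 \<le> s x)"
proof -
  have "openin (top_of_set X) {x \<in> X. r x = r x0}"
    using \<phi> by (simp add: orbit_morphism_def continuous_on_discrete_iff)
  then obtain N where N: "\<And>x. x \<in> X \<Longrightarrow> \<exists>i\<in>{1..N}. (T ^^ i) x \<in> {x \<in> X. r x = r x0}"
    using uniform_visits[of "{x \<in> X. r x = r x0}"] \<open>x0 \<in> X\<close> by blast
  \<comment> \<open>A visit at a time in \<open>{1..N}\<close> falls among the indices below
    \<open>Suc N\<close> of the Birkhoff sum.\<close>
  define K where "K = Suc N"
  have "K + 1 \<le> birkhoff T r K x" if "x \<in> X" for x
  proof -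
    obtain i where i: "i \<in> {1..N}" "r ((T ^^ i) x) = r x0"
      using N[OF \<open>x \<in> X\<close>] by blast
    have "(\<Sum>j<K. 1::nat) < (\<Sum>j<K. r ((T ^^ j) x))"
    proof (rule sum_strict_mono_ex1)
      show "\<forall>j\<in>{..<K}. 1 \<le> r ((T ^^ j) x)"
        using pos funpow_in that by blast
      have "1 < r ((T ^^ i) x)"
        using i pos[OF \<open>x0 \<in> X\<close>] \<open>r x0 \<noteq> 1\<close> by simp
      then show "\<exists>j\<in>{..<K}. 1 < r ((T ^^ j) x)"
        using i by (intro bexI[of _ i]) (auto simp: K_def)
    qed simp
    then show ?thesis
      by (simp add: birkhoff_def)
  qed
  from birkhoff_lower_bound[OF pos this]
  have "\<And>x n. x \<in> X \<Longrightarrow> n + n div K \<le> birkhoff T r n x" .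
  \<comment> \<open>With \<open>2 * K\<close> compositions the gain is at least
    \<open>2 * n - 2 * K\<close>, which is at least \<open>n\<close> as soon as
    \<open>n \<ge> 2 * K\<close>.\<close>
  from orbit_morphism_iterate[OF \<phi> this, of "2 * K"] obtain \<psi> s where \<psi>: "orbit_morphism \<psi> s"
    and s: "\<And>x n. x \<in> X \<Longrightarrow> n + 2 * K * (n div K) \<le> birkhoff T s n x"
    by blast
  have "2 * n \<le> birkhoff T s n x" if "x \<in> X" "2 * K \<le> n" for x n
  proof -
    have "n mod K < K"
      by (simp add: K_def)
    then have "n \<le> K * (n div K) + K"
      by (metis add_mono_thms_linordered_semiring(2) less_imp_le mult_div_mod_eq)
    with that(2) have "2 * n \<le> n + 2 * K * (n div K)"
      by simp
    with s[OF that(1), of n] show ?thesis by simp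
  qed
  with orbit_morphism_regularize[OF \<psi>] show ?thesis by blast
qed

end

section \<open>Codings and the substitution\<close>

lemma finite_compact_discrete:
  fixes S :: "'b::discrete_topology set"
  assumes "compact S"
  shows "finite S"
proof -
  obtain C where "C \<subseteq> S" "finite C" "S \<subseteq> (\<Union>x\<in>C. {x})"
    by (rule compactE_image[OF assms, of S "\<lambda>x. {x}"]) (auto simp: open_discrete)
  then show ?thesis
    by (auto intro: finite_subset)
qed

text \<open>A continuous bijection from a compact space onto a Hausdorff space is a homeomorphism;
  here the target is Hausdorff as a subspace of a product.\<close>

lemma homeomorphism_compact_into_product:
  fixes f :: "'a::topological_space \<Rightarrow> 'i \<Rightarrow> 'b::t2_space"
  assumes "compact S" "continuous_on S f" "f ` S = Y" "inj_on f S"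
  shows "\<exists>g. homeomorphism S Y f g"
proof -
  have "Hausdorff_space (product_topology (\<lambda>_. euclidean :: 'b topology) (UNIV :: 'i set))"
    unfolding Hausdorff_space_product_topology
    using hausdorff by (simp add: Hausdorff_space_def disjnt_def) blast
  then have "Hausdorff_space (top_of_set Y)"
    by (simp add: euclidean_product_topology Hausdorff_space_subtopology)
  then have "homeomorphic_map (top_of_set S) (top_of_set Y) f"
    using assms by (intro continuous_imp_homeomorphic_map) (auto simp: compact_space_subtopology)
  then obtain g where "homeomorphic_maps (top_of_set S) (top_of_set Y) f g"
    by (auto simp: homeomorphic_map_maps)
  then have "homeomorphism S Y f g"
    by (intro homeomorphismI) (auto simp: homeomorphic_maps_def)
  then show ?thesis by blast
qed

section \<open>Generating codes, the substitution and its subshift\<close>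

context minimal_homeomorphism
begin

text \<open>A clopen generator in the sense of symbolic dynamics: coding by two-sided itineraries is
  injective.\<close>

definition generating :: "('a \<Rightarrow> nat) \<Rightarrow> bool" where
  "generating c \<longleftrightarrow> continuous_on X c
     \<and> (\<forall>x\<in>X. \<forall>y\<in>X. (\<forall>n. c (P n x) = c (P n y)) \<longrightarrow> x = y)"

lemma eventually_code_eq:
  fixes c :: "'a \<Rightarrow> 'b::discrete_topology"
  assumes "continuous_on X c" "u \<longlonglongrightarrow> a" "a \<in> X" "\<And>n. u n \<in> X"
  shows "eventually (\<lambda>n. c (P i (u n)) = c (P i a)) sequentially"
proof -
  have "(\<lambda>n. c (P i (u n))) \<longlonglongrightarrow> c (P i a)"
    using continuous_on_tendsto_compose[OF continuous_on_comp_P[OF assms(1), of i] assms(2,3)] assms(4)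
    by simp
  then show ?thesis
    by (simp add: tendsto_discrete)
qed

text \<open>Otherwise pairs agreeing on ever larger windows but with different
  \<open>f\<close>-values would accumulate at a pair with equal itineraries, that is, at a diagonal
  point, where \<open>f\<close> is locally constant.\<close>

lemma window_determines:
  fixes f :: "'a \<Rightarrow> nat"
  assumes c: "generating c" and f: "continuous_on X f"
  obtains M :: nat where
    "\<And>x y. x \<in> X \<Longrightarrow> y \<in> X \<Longrightarrow> (\<And>i. \<bar>i\<bar> \<le> int M \<Longrightarrow> c (P i x) = c (P i y)) \<Longrightarrow> f x = f y"
proof (rule ccontr)
  assume no: "\<not> thesis"
  have "\<exists>x y. x \<in> X \<and> y \<in> X \<and> (\<forall>i. \<bar>i\<bar> \<le> int M \<longrightarrow> c (P i x) = c (P i y)) \<and> f x \<noteq> f y" for M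
    using no that by blast
  then obtain u v where u: "\<And>n. u n \<in> X" and v: "\<And>n. v n \<in> X"
    and eq: "\<And>n i. \<bar>i\<bar> \<le> int n \<Longrightarrow> c (P i (u n)) = c (P i (v n))" and ne: "\<And>n. f (u n) \<noteq> f (v n)"
    by metis
  \<comment> \<open>Working with pairs makes both sequences converge along one subsequence.\<close>
  have "seq_compact (X \<times> X)"
    using compact by (simp add: compact_Times flip: compact_eq_seq_compact_metric)
  then obtain l s where l: "l \<in> X \<times> X" "strict_mono s" "((\<lambda>n. (u n, v n)) \<circ> s) \<longlonglongrightarrow> l"
    by (rule seq_compactE[where f = "\<lambda>n. (u n, v n)"]) (use u v in auto)
  obtain a b where ab: "l = (a, b)" "a \<in> X" "b \<in> X"
    using l(1) by auto
  have ua: "(\<lambda>n. u (s n)) \<longlonglongrightarrow> a" and vb: "(\<lambda>n. v (s n)) \<longlonglongrightarrow> b"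
    using tendsto_fst[OF l(3)] tendsto_snd[OF l(3)] ab(1) by (simp_all add: o_def)
  have "c (P i a) = c (P i b)" for i
  proof -
    have "continuous_on X c" using c by (simp add: generating_def)
    from eventually_code_eq[OF this ua ab(2) u, of i] eventually_code_eq[OF this vb ab(3) v, of i]
    have "eventually (\<lambda>n. c (P i (u (s n))) = c (P i a) \<and> c (P i (v (s n))) = c (P i b)
        \<and> n \<ge> nat \<bar>i\<bar>) sequentially"
      using eventually_ge_at_top[of "nat \<bar>i\<bar>"] by eventually_elim simp
    then obtain n where n: "c (P i (u (s n))) = c (P i a)" "c (P i (v (s n))) = c (P i b)" "n \<ge> nat \<bar>i\<bar>"
      by (auto simp: eventually_sequentially)
    have "\<bar>i\<bar> \<le> int (s n)"
      using n(3) seq_suble[OF l(2), of n] by linarith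
    with eq n show ?thesis by metis
  qed
  with c ab have "a = b"
    by (auto simp: generating_def)
  have "eventually (\<lambda>n. f (u (s n)) = f a \<and> f (v (s n)) = f b) sequentially"
    using eventually_code_eq[OF f ua ab(2) u, of 0] eventually_code_eq[OF f vb ab(3) v, of 0]
    by eventually_elim simp
  then obtain n where "f (u (s n)) = f a" "f (v (s n)) = f b"
    by (auto simp: eventually_sequentially)
  with \<open>a = b\<close> ne show False by metis
qed

lemma birkhoff_ge_double:
  assumes two: "\<And>x. x \<in> X \<Longrightarrow> 2 \<le> r x" and "x \<in> X"
  shows "2 * n \<le> birkhoff T r n x"
proof (induction n)
  case (Suc n)
  with two[OF funpow_in[OF \<open>x \<in> X\<close>, of n]] show ?case by (simp add: birkhoff_Suc)
qed simp

text \<open>By \<open>orbit_morphism_funpow\<close> each block starts where the previous one ends,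
  so the long itinerary is the concatenation of the blocks.\<close>

lemma itinerary_image_cong:
  assumes \<phi>: "orbit_morphism \<phi> r" and "x \<in> X" "y \<in> X"
    and eq: "\<And>k. k < n \<Longrightarrow> itinerary T c (r ((T ^^ k) x)) (\<phi> ((T ^^ k) x))
                        = itinerary T c (r ((T ^^ k) y)) (\<phi> ((T ^^ k) y))"
  shows "itinerary T c (birkhoff T r n x) (\<phi> x) = itinerary T c (birkhoff T r n y) (\<phi> y)"
  using eq
proof (induction n)
  case 0
  then show ?case by (simp add: itinerary_def)
next
  case (Suc n)
  then show ?case
    unfolding birkhoff_Suc itinerary_add orbit_morphism_funpow[OF \<phi> \<open>x \<in> X\<close>, symmetric]
      orbit_morphism_funpow[OF \<phi> \<open>y \<in> X\<close>, symmetric] by simp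
qed

text \<open>The letters of \<open>\<phi> x\<close> in a window of radius \<open>2 * M\<close> are spelled by at most \<open>M\<close> return blocks
  on either side, because each block has length at least two; and these blocks are read off
  the letters of \<open>x\<close> in a window of radius \<open>M + M\<close>.\<close>

lemma substitutive_code:
  assumes \<phi>: "orbit_morphism \<phi> r" and two: "\<And>x. x \<in> X \<Longrightarrow> 2 \<le> r x" and c: "generating c"
  obtains C where "generating C"
    "\<And>x y. x \<in> X \<Longrightarrow> y \<in> X \<Longrightarrow> C x = C y \<Longrightarrow> itinerary T C (r x) (\<phi> x) = itinerary T C (r y) (\<phi> y)"
proof -
  have cc: "continuous_on X c" using c by (simp add: generating_def)
  have "continuous_on X (\<lambda>x. to_nat (itinerary T c (r x) (\<phi> x)))"
  proof (rule continuous_on_discrete_parameter[where k = r and F = "\<lambda>v x. to_nat (itinerary T c v (\<phi> x))"])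
    show "continuous_on X r"
      using \<phi> by (simp add: orbit_morphism_def)
    show "continuous_on X (\<lambda>x. to_nat (itinerary T c v (\<phi> x)))" for v
      using \<phi> by (intro continuous_on_compose2[OF continuous_on_itinerary_code[OF cc, of v], of X \<phi>])
        (auto simp: orbit_morphism_def)
  qed
  from window_determines[OF c this] obtain M :: nat where
    M: "\<And>x y. x \<in> X \<Longrightarrow> y \<in> X \<Longrightarrow> (\<And>i. \<bar>i\<bar> \<le> int M \<Longrightarrow> c (P i x) = c (P i y)) \<Longrightarrow>
          itinerary T c (r x) (\<phi> x) = itinerary T c (r y) (\<phi> y)"
    by (metis (mono_tags, lifting) inj_eq inj_to_nat)
  define N where "N = 2 * int M"
  define C where "C x = to_nat (map (\<lambda>i. c (P i x)) [- N..N])" for x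
  have C_eq: "C x = C y \<longleftrightarrow> (\<forall>i. \<bar>i\<bar> \<le> N \<longrightarrow> c (P i x) = c (P i y))" for x y
    by (auto simp: C_def abs_le_iff)
  have big: "2 * n \<le> birkhoff T r n x" if "x \<in> X" for x n
    using two that by (rule birkhoff_ge_double)
  show thesis
  proof
    have "continuous_on X C"
    proof (rule continuous_on_discrete_determined[where I = "{- N..N}" and g = "\<lambda>i x. c (P i x)"])
      show "continuous_on X (\<lambda>x. c (P i x))" for i
        using cc by (rule continuous_on_comp_P)
    qed (auto simp: C_eq abs_le_iff)
    moreover have "c x = c y" if "C x = C y" for x y
    proof -
      have "c (P 0 x) = c (P 0 y)"
        using that unfolding C_eq N_def by (auto simp del: P_0)
      then show ?thesis by simp
    qed
    ultimately show "generating C"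
      using c unfolding generating_def by blast
  next
    fix x y assume x: "x \<in> X" and y: "y \<in> X" and "C x = C y"
    then have eq: "c (P i x) = c (P i y)" if "\<bar>i\<bar> \<le> N" for i
      using that C_eq by blast
    \<comment> \<open>Starting \<open>M\<close> steps in the past makes all \<open>2 * M + 1\<close>
      blocks forward ones, with the block of \<open>x\<close> at index \<open>M\<close>.\<close>
    define x' y' where "x' = P (- int M) x" and "y' = P (- int M) y"
    have x': "x' \<in> X" "(T ^^ M) x' = x" and y': "y' \<in> X" "(T ^^ M) y' = y"
      using P_in P_minus x y by (auto simp: x'_def y'_def simp flip: P_nat)
    \<comment> \<open>Block \<open>k\<close> is determined by the letters at positions
      \<open>k - M + i\<close> of \<open>x\<close> with \<open>\<bar>i\<bar> \<le> M\<close>; for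
      \<open>k \<le> 2 * M\<close> these stay within radius \<open>2 * M\<close>.\<close>
    have block: "itinerary T c (r ((T ^^ k) x')) (\<phi> ((T ^^ k) x'))
        = itinerary T c (r ((T ^^ k) y')) (\<phi> ((T ^^ k) y'))" if "k \<le> 2 * M" for k
    proof (rule M)
      show "(T ^^ k) x' \<in> X" "(T ^^ k) y' \<in> X"
        using x' y' funpow_in by auto
      show "c (P i ((T ^^ k) x')) = c (P i ((T ^^ k) y'))" if "\<bar>i\<bar> \<le> int M" for i
      proof -
        have *: "P i ((T ^^ k) (P (- int M) z)) = P (i + int k - int M) z" if "z \<in> X" for z
          using P_funpow[OF P_in[OF that], of i k "- int M"] P_add[OF that, of "i + int k" "- int M"]
          by simp
        show ?thesis
          unfolding x'_def y'_def *[OF x] *[OF y]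
          using that \<open>k \<le> 2 * M\<close> by (intro eq) (auto simp: N_def)
      qed
    qed
    define B where "B = birkhoff T r M x'"
    have "itinerary T c B (\<phi> x') = itinerary T c (birkhoff T r M y') (\<phi> y')"
      unfolding B_def using block by (intro itinerary_image_cong[OF \<phi> x'(1) y'(1)]) auto
    then have By: "birkhoff T r M y' = B"
      by (metis length_itinerary)
    have rxy: "r x = r y"
      using block[of M] x' y' by (simp add: itinerary_eq_iff)
    \<comment> \<open>The total length of \<open>M\<close> blocks before \<open>x\<close>, the block
      of \<open>x\<close> and \<open>M\<close> blocks after it.\<close>
    define L where "L = birkhoff T r (Suc (2 * M)) x'"
    have "itinerary T c L (\<phi> x') = itinerary T c (birkhoff T r (Suc (2 * M)) y') (\<phi> y')"
      unfolding L_def using block by (intro itinerary_image_cong[OF \<phi> x'(1) y'(1)]) auto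
    then have all: "c ((T ^^ j) (\<phi> x')) = c ((T ^^ j) (\<phi> y'))" if "j < L" for j
      using that by (simp add: itinerary_eq_iff)
    have "L = B + (r x + birkhoff T r M (T x))"
      using birkhoff_add[of T r M "1 + M" x'] birkhoff_add[of T r 1 M x] x'
      by (simp add: L_def B_def mult_2)
    then have L: "B + r x + 2 * M \<le> L"
      using big[OF T_in[OF x], of M] by simp
    have B: "2 * M \<le> B"
      using big[OF x'(1)] by (simp add: B_def)
    have px: "\<phi> x = (T ^^ B) (\<phi> x')" and py: "\<phi> y = (T ^^ B) (\<phi> y')"
      using orbit_morphism_funpow[OF \<phi> x'(1), of M] orbit_morphism_funpow[OF \<phi> y'(1), of M] x' y' By
      by (simp_all add: B_def)
    have "C ((T ^^ i) (\<phi> x)) = C ((T ^^ i) (\<phi> y))" if "i < r x" for i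
      unfolding C_eq
    proof (intro allI impI)
      fix j assume j: "\<bar>j\<bar> \<le> N"
      \<comment> \<open>The position counted from \<open>\<phi> x'\<close>. At least
        \<open>2 * M\<close> compared letters precede \<open>\<phi> x\<close> and at least
        \<open>2 * M\<close> follow its block, so it lies between 0 and \<open>L\<close>.\<close>
      define m where "m = nat (j + int i + int B)"
      have m: "int m = j + int i + int B" "m < L"
        using j B L that by (auto simp: m_def N_def)
      have *: "P j ((T ^^ i) ((T ^^ B) z)) = (T ^^ m) z" if "z \<in> X" for z
        using P_funpow[OF funpow_in[OF that], of j i B] P_funpow[OF that, of "j + int i" B] m(1)
        by (simp flip: P_nat)
      show "c (P j ((T ^^ i) (\<phi> x))) = c (P j ((T ^^ i) (\<phi> y)))"
        unfolding px py using * orbit_morphism_in[OF \<phi>] x' y' all[OF m(2)] by simp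
    qed
    then show "itinerary T C (r x) (\<phi> x) = itinerary T C (r y) (\<phi> y)"
      using rxy by (simp add: itinerary_eq_iff)
  qed
qed

text \<open>Uniform recurrence: the word of \<open>z\<close> is read from an open set of points,
  which every orbit visits within bounded time; \<open>n\<close> further letters complete the
  word.\<close>

lemma itinerary_recurrence:
  fixes C :: "'a \<Rightarrow> nat"
  assumes "continuous_on X C" "z \<in> X"
  obtains N where "\<And>y m. y \<in> X \<Longrightarrow> N \<le> m \<Longrightarrow> sublist (itinerary T C n z) (itinerary T C m y)"
proof -
  let ?V = "{y \<in> X. to_nat (itinerary T C n y) = to_nat (itinerary T C n z)}"
  have "openin (top_of_set X) ?V"
    using continuous_on_itinerary_code[OF assms(1)] unfolding continuous_on_discrete_iff by blast
  then obtain N where N: "\<And>y. y \<in> X \<Longrightarrow> \<exists>i\<in>{1..N}. (T ^^ i) y \<in> ?V"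
    using uniform_visits[of ?V] assms(2) by blast
  show thesis
  proof
    fix y m assume "y \<in> X" "N + n \<le> m"
    then obtain i where "i \<le> N" "itinerary T C n ((T ^^ i) y) = itinerary T C n z"
      using N by fastforce
    with sublist_itinerary[of i n m T C y] \<open>N + n \<le> m\<close>
    show "sublist (itinerary T C n z) (itinerary T C m y)" by simp
  qed
qed

text \<open>Iterating the substitution on a letter yields itineraries of unbounded length. Uniform
  recurrence then gives primitivity and puts every coded point into the subshift; compactness gives
  the converse inclusion.\<close>

lemma substitution_conjugacy:
  assumes \<phi>: "orbit_morphism \<phi> r" and two: "\<And>x. x \<in> X \<Longrightarrow> 2 \<le> r x" and C: "generating C"
    and det: "\<And>x y. x \<in> X \<Longrightarrow> y \<in> X \<Longrightarrow> C x = C y \<Longrightarrow>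
                itinerary T C (r x) (\<phi> x) = itinerary T C (r y) (\<phi> y)"
  shows "\<exists>(A::nat set) \<sigma>. primitive_subst A \<sigma> \<and> top_conj X T (subst_shift A \<sigma>) shift"
proof -
  have cC: "continuous_on X C" using C by (simp add: generating_def)
  define A where "A = C ` X"
  \<comment> \<open>Any point with letter \<open>a\<close> may be chosen, since \<open>det\<close>
    makes the word independent of the choice.\<close>
  define \<sigma> where "\<sigma> a = (let z = SOME z. z \<in> X \<and> C z = a in itinerary T C (r z) (\<phi> z))" for a
  have \<sigma>: "\<sigma> (C x) = itinerary T C (r x) (\<phi> x)" if "x \<in> X" for x
  proof -
    have "(SOME z. z \<in> X \<and> C z = C x) \<in> X \<and> C (SOME z. z \<in> X \<and> C z = C x) = C x"
      using that by (intro someI[of "\<lambda>z. z \<in> X \<and> C z = C x"]) auto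
    then show ?thesis
      unfolding \<sigma>_def Let_def using that by (intro det) auto
  qed
  \<comment> \<open>On itineraries the substitution acts as \<open>\<phi>\<close> acts on points,
    and lengths become Birkhoff sums.\<close>
  have step: "subst_word \<sigma> (itinerary T C n x) = itinerary T C (birkhoff T r n x) (\<phi> x)" if "x \<in> X" for n x
  proof (induction n)
    case 0
    then show ?case by (simp add: subst_word_def itinerary_def)
  next
    case (Suc n)
    have "subst_word \<sigma> [C ((T ^^ n) x)] = \<sigma> (C ((T ^^ n) x))"
      by (simp add: subst_word_def)
    then show ?case
      using Suc itinerary_add[of T C n 1 x] \<sigma>[OF funpow_in[OF that, of n]]
        orbit_morphism_funpow[OF \<phi> that, of n]
      by (simp add: subst_word_append birkhoff_Suc itinerary_add)
  qed
  have big: "2 * n \<le> birkhoff T r n x" if "x \<in> X" for x n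
    using two that by (rule birkhoff_ge_double)
  \<comment> \<open>The length starts at 1 and at least doubles at each application, so it exceeds
    \<open>k\<close>.\<close>
  have power: "\<exists>y\<in>X. \<exists>m>k. (subst_word \<sigma> ^^ k) [C x] = itinerary T C m y" if "x \<in> X" for x k
  proof (induction k)
    case 0
    have "(subst_word \<sigma> ^^ 0) [C x] = itinerary T C 1 x" by simp
    then show ?case using that zero_less_one by blast
  next
    case (Suc k)
    then obtain y m where y: "y \<in> X" "k < m" "(subst_word \<sigma> ^^ k) [C x] = itinerary T C m y"
      by blast
    then have "(subst_word \<sigma> ^^ Suc k) [C x] = itinerary T C (birkhoff T r m y) (\<phi> y)"
      by (simp add: step)
    moreover have "Suc k < birkhoff T r m y"
      using big[OF y(1), of m] y(2) by simp
    ultimately show ?case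
      using orbit_morphism_in[OF \<phi> y(1)] by blast
  qed
  have finA: "finite A"
    unfolding A_def using compact cC by (intro finite_compact_discrete compact_continuous_image)
  have "substitution A \<sigma>"
    unfolding substitution_def
  proof (intro conjI ballI)
    fix a assume "a \<in> A"
    then obtain x where x: "x \<in> X" "a = C x" by (auto simp: A_def)
    with two[OF x(1)] have "length (\<sigma> a) \<noteq> 0" by (simp add: \<sigma>)
    then show "\<sigma> a \<noteq> []" by auto
    show "set (\<sigma> a) \<subseteq> A"
      using x orbit_morphism_in[OF \<phi> x(1)] funpow_in by (auto simp: \<sigma> itinerary_def A_def)
  qed (rule finA)
  moreover have "\<exists>n. \<forall>a\<in>A. \<forall>b\<in>A. b \<in> set ((subst_word \<sigma> ^^ n) [a])"
  proof -
    have "\<exists>N. \<forall>y\<in>X. \<forall>m\<ge>N. b \<in> set (itinerary T C m y)" if "b \<in> A" for b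
    proof -
      obtain z where z: "z \<in> X" "b = C z" using \<open>b \<in> A\<close> by (auto simp: A_def)
      from itinerary_recurrence[OF cC z(1), of 1] obtain N
        where "\<And>y m. y \<in> X \<Longrightarrow> N \<le> m \<Longrightarrow> sublist (itinerary T C 1 z) (itinerary T C m y)"
        by blast
      then have "\<forall>y\<in>X. \<forall>m\<ge>N. b \<in> set (itinerary T C m y)"
        using z(2) by (fastforce dest: set_mono_sublist)
      then show ?thesis by blast
    qed
    then obtain N where N: "\<And>b y m. b \<in> A \<Longrightarrow> y \<in> X \<Longrightarrow> N b \<le> m \<Longrightarrow> b \<in> set (itinerary T C m y)"
      by metis
    \<comment> \<open>The sum of the \<open>N b\<close> is an exponent valid for all letters at
      once: the word is longer than the exponent, hence longer than each \<open>N b\<close>.\<close>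
    have "b \<in> set ((subst_word \<sigma> ^^ (\<Sum>b\<in>A. N b)) [a])" if "a \<in> A" "b \<in> A" for a b
    proof -
      obtain x where "x \<in> X" "a = C x" using \<open>a \<in> A\<close> by (auto simp: A_def)
      then obtain y m where y: "y \<in> X" "(\<Sum>b\<in>A. N b) < m"
          "(subst_word \<sigma> ^^ (\<Sum>b\<in>A. N b)) [a] = itinerary T C m y"
        using power by blast
      have "N b \<le> (\<Sum>b\<in>A. N b)"
        using finA \<open>b \<in> A\<close> by (intro member_le_sum) auto
      also have "\<dots> \<le> m"
        using y(2) by simp
      finally show ?thesis
        using N \<open>b \<in> A\<close> y by simp
    qed
    then show ?thesis by blast
  qed
  moreover have "\<exists>a\<in>A. filterlim (\<lambda>k. length ((subst_word \<sigma> ^^ k) [a])) at_top sequentially"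
  proof -
    obtain x where x: "x \<in> X" using nonempty by auto
    have "k \<le> length ((subst_word \<sigma> ^^ k) [C x])" for k
      using power[OF x, of k] by fastforce
    then have "filterlim (\<lambda>k. length ((subst_word \<sigma> ^^ k) [C x])) at_top sequentially"
      by (intro filterlim_at_top_mono[OF filterlim_ident]) simp
    with x show ?thesis by (auto simp: A_def)
  qed
  ultimately have prim: "primitive_subst A \<sigma>"
    unfolding primitive_subst_def by blast

  define \<pi> where "\<pi> x = (\<lambda>i. C (P i x))" for x
  have factor: "factor_of (\<pi> x) i n = itinerary T C n (P i x)" if "x \<in> X" for x i n
  proof -
    have "P (i + int j) x = (T ^^ j) (P i x)" for j
      using P_add[OF that, of "int j" i] by (simp add: P_nat add.commute)
    then show ?thesis
      by (simp add: factor_of_def itinerary_def \<pi>_def)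
  qed
  have "\<pi> ` X = subst_shift A \<sigma>"
  proof
    show "\<pi> ` X \<subseteq> subst_shift A \<sigma>"
      unfolding subst_shift_def
    proof (clarify, intro conjI allI)
      fix x assume x: "x \<in> X"
      show "\<pi> x i \<in> A" for i
        using P_in[OF x] by (simp add: \<pi>_def A_def)
      fix i n
      have z: "P i x \<in> X" using P_in[OF x] .
      from itinerary_recurrence[OF cC z, of n] obtain N
        where N: "\<And>y m. y \<in> X \<Longrightarrow> N \<le> m \<Longrightarrow> sublist (itinerary T C n (P i x)) (itinerary T C m y)"
        by blast
      \<comment> \<open>The exponent \<open>Suc N\<close> makes the word longer than
        \<open>N\<close> and is at least 1, as the subshift demands.\<close>
      obtain y m where y: "y \<in> X" "Suc N < m" "(subst_word \<sigma> ^^ Suc N) [C x] = itinerary T C m y"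
        using power[OF x] by blast
      have "N \<le> m"
        using y(2) by simp
      with N[OF y(1)] y(3) have "sublist (factor_of (\<pi> x) i n) ((subst_word \<sigma> ^^ Suc N) [C x])"
        by (simp add: factor[OF x])
      then show "\<exists>a\<in>A. \<exists>k\<ge>1. sublist (factor_of (\<pi> x) i n) ((subst_word \<sigma> ^^ k) [a])"
        using x unfolding A_def by (metis imageI le_add1 plus_1_eq_Suc)
    qed
    show "subst_shift A \<sigma> \<subseteq> \<pi> ` X"
    proof
      fix w assume w: "w \<in> subst_shift A \<sigma>"
      \<comment> \<open>The central factor of \<open>w\<close> of length \<open>2 * n + 1\<close>
        occurs in an itinerary, say from \<open>u\<close>; the point \<open>n\<close> steps after
        \<open>u\<close> then matches \<open>w\<close> on \<open>{- n..n}\<close>. A limit of such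
        points is coded by \<open>w\<close>.\<close>
      have "\<exists>x\<in>X. \<forall>j. \<bar>j\<bar> \<le> int n \<longrightarrow> C (P j x) = w j" for n
      proof -
        let ?f = "factor_of w (- int n) (2 * n + 1)"
        obtain a k where a: "a \<in> A" "sublist ?f ((subst_word \<sigma> ^^ k) [a])"
          using w unfolding subst_shift_def by blast
        then obtain z where "z \<in> X" "a = C z" by (auto simp: A_def)
        then obtain y m where y: "y \<in> X" "(subst_word \<sigma> ^^ k) [a] = itinerary T C m y"
          using power by blast
        from a(2)[unfolded y(2)] obtain i where "?f = itinerary T C (length ?f) ((T ^^ i) y)"
          by (rule sublist_itineraryD)
        moreover define u where "u = (T ^^ i) y"
        ultimately have fu: "?f = itinerary T C (2 * n + 1) u"
          by (simp add: factor_of_def)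
        have u: "u \<in> X" using y(1) funpow_in by (simp add: u_def)
        have "C (P j (P (int n) u)) = w j" if "\<bar>j\<bar> \<le> int n" for j
        proof -
          define l where "l = nat (j + int n)"
          have l: "int l = j + int n" "l < 2 * n + 1" using that by (auto simp: l_def)
          have "w j = ?f ! l"
            using l by (simp add: factor_of_def del: upt_Suc)
          also have "\<dots> = C ((T ^^ l) u)"
            unfolding fu using l(2) by (rule nth_itinerary)
          finally show ?thesis
            using P_add[OF u, of j "int n"] l(1) by (simp flip: P_nat)
        qed
        then show ?thesis using P_in[OF u] by blast
      qed
      then obtain v where v: "\<And>n. v n \<in> X" "\<And>n j. \<bar>j\<bar> \<le> int n \<Longrightarrow> C (P j (v n)) = w j"
        by metis
      have "seq_compact X"
        using compact by (simp flip: compact_eq_seq_compact_metric)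
      then obtain x s where x: "x \<in> X" "strict_mono s" "(v \<circ> s) \<longlonglongrightarrow> x"
        by (rule seq_compactE[where f = v]) (use v(1) in auto)
      have "C (P j x) = w j" for j
      proof -
        have "eventually (\<lambda>n. C (P j ((v \<circ> s) n)) = C (P j x) \<and> n \<ge> nat \<bar>j\<bar>) sequentially"
          using v(1) by (intro eventually_conj eventually_code_eq[OF cC x(3,1)] eventually_ge_at_top) auto
        then obtain n where n: "C (P j (v (s n))) = C (P j x)" "n \<ge> nat \<bar>j\<bar>"
          by (auto simp: eventually_sequentially)
        have "\<bar>j\<bar> \<le> int (s n)"
          using n(2) seq_suble[OF x(2), of n] by linarith
        with v(2) n(1) show ?thesis by metis
      qed
      then have "w = \<pi> x" by (auto simp: \<pi>_def)
      with x(1) show "w \<in> \<pi> ` X" by blast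
    qed
  qed
  moreover have "continuous_on X \<pi>"
    unfolding \<pi>_def by (intro continuous_on_coordinatewise_then_product continuous_on_comp_P cC)
  moreover have "inj_on \<pi> X"
    using C by (auto simp: inj_on_def \<pi>_def generating_def fun_eq_iff)
  ultimately obtain g where "homeomorphism X (subst_shift A \<sigma>) \<pi> g"
    using homeomorphism_compact_into_product[OF compact] by metis
  moreover have "\<pi> (T x) = shift (\<pi> x)" if "x \<in> X" for x
    using P_add[OF that, of _ 1] P_nat[of 1] by (simp add: \<pi>_def shift_def)
  ultimately have "top_conj X T (subst_shift A \<sigma>) shift"
    unfolding top_conj_def by blast
  with prim show ?thesis by blast
qed

section \<open>Induced maps\<close>

text \<open>Uniform visits bound the return time by some \<open>N\<close>, so it depends only on
  which of the first \<open>N\<close> iterates lie in \<open>U\<close>.\<close>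

lemma return_time_clopen:
  assumes U: "U \<noteq> {}" "clopen_in X U"
  shows "continuous_on X (return_time T U)"
    and "\<And>x. x \<in> X \<Longrightarrow> 1 \<le> return_time T U x"
    and "\<And>x. x \<in> X \<Longrightarrow> induced_map T U x \<in> U"
proof -
  have op: "openin (top_of_set X) U" and cl: "closedin (top_of_set X) U"
    using U(2) by (auto simp: clopen_in_def)
  from uniform_visits[OF op U(1)] obtain N where
    N: "\<And>x. x \<in> X \<Longrightarrow> \<exists>i\<in>{1..N}. (T ^^ i) x \<in> U"
    by blast
  have rt: "0 < return_time T U x \<and> (T ^^ return_time T U x) x \<in> U" if "x \<in> X" for x
  proof -
    from N[OF that] have "\<exists>i. 0 < i \<and> (T ^^ i) x \<in> U"
      by (meson atLeastAtMost_iff less_le_trans zero_less_one)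
    then show ?thesis
      unfolding return_time_def by (rule LeastI_ex)
  qed
  then show "1 \<le> return_time T U x" "induced_map T U x \<in> U" if "x \<in> X" for x
    using that by (simp_all add: Suc_le_eq induced_map_def)
  have le: "return_time T U x \<le> N" if "x \<in> X" for x
  proof -
    from N[OF that] obtain i where "i \<in> {1..N}" "(T ^^ i) x \<in> U"
      by blast
    then have "return_time T U x \<le> i"
      unfolding return_time_def by (intro Least_le) auto
    with \<open>i \<in> {1..N}\<close> show ?thesis by simp
  qed
  \<comment> \<open>The return time of \<open>y\<close> is a visiting time for \<open>x\<close> as
    well, hence bounds the least one; equality follows by symmetry.\<close>
  have rle: "return_time T U x \<le> return_time T U y"
    if "x \<in> X" "y \<in> X" "\<And>i. i \<in> {..N} \<Longrightarrow> ((T ^^ i) x \<in> U) = ((T ^^ i) y \<in> U)" for x y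
  proof -
    have "0 < return_time T U y \<and> (T ^^ return_time T U y) x \<in> U"
      using rt[OF that(2)] le[OF that(2)] that(3) by auto
    then show ?thesis
      unfolding return_time_def[of T U x] by (rule Least_le)
  qed
  show "continuous_on X (return_time T U)"
  proof (rule continuous_on_discrete_determined[where I = "{..N}" and g = "\<lambda>i x. (T ^^ i) x \<in> U"])
    show "continuous_on X (\<lambda>x. (T ^^ i) x \<in> U)" for i
      using continuous_on_comp_funpow[OF continuous_on_clopen_indicator[OF op cl]] .
    show "return_time T U x = return_time T U y"
      if "x \<in> X" "y \<in> X" "\<And>i. i \<in> {..N} \<Longrightarrow> ((T ^^ i) x \<in> U) = ((T ^^ i) y \<in> U)" for x y
      using that rle[of x y] rle[of y x] by (simp add: order_antisym)
  qed simp
qed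

lemma invariant_closed_eq:
  assumes "closedin (top_of_set X) U" "U \<noteq> {}" and inv: "T ` U = U"
  shows "U = X"
proof -
  have UX: "U \<subseteq> X" and "closed U"
    using assms(1) closedin_imp_subset compact_imp_closed[OF compact] closedin_closed_trans by blast+
  obtain u where u: "u \<in> U" using assms(2) by auto
  have "P n u \<in> U" for n
  proof (induction n rule: int_induct[where k = 0])
    case base
    show ?case using u by simp
  next
    case (step1 i)
    then show ?case using P_Suc[of u i] u UX inv by auto
  next
    case (step2 i)
    then obtain w where "w \<in> U" "P i u = T w"
      using inv by blast
    moreover have "u \<in> X" "w \<in> X"
      using u \<open>w \<in> U\<close> UX by auto
    ultimately show ?case
      using P_pred[of u i] inv_T by simp
  qed
  then have "closure (orbit X T u) \<subseteq> U"
    using \<open>closed U\<close> by (intro closure_minimal) (auto simp: orbit_def)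
  with dense[of u] u UX show ?thesis by blast
qed

end

section \<open>Application to expansive self-induced systems\<close>

theorem mainTheorem1:
  fixes X :: "'a::metric_space set" and T :: "'a \<Rightarrow> 'a"
  assumes "minimal_cantor_system X T" and "self_induced X T" and "expansive X T"
  shows "\<exists>(A::nat set) \<sigma>. primitive_subst A \<sigma> \<and> top_conj X T (subst_shift A \<sigma>) shift"
proof -
  interpret minimal_homeomorphism X T
    using assms(1) by unfold_locales (auto simp: minimal_cantor_system_def cantor_set_def)
  obtain U h g where U: "U \<noteq> {}" "U \<subset> X" "clopen_in X U" and hg: "homeomorphism U X h g"
    and conj: "\<And>u. u \<in> U \<Longrightarrow> h (induced_map T U u) = T (h u)"
    using assms(2) unfolding self_induced_def top_conj_def by blast
  have g: "continuous_on X g" "g ` X = U" "\<And>x. x \<in> X \<Longrightarrow> h (g x) = x" "\<And>u. u \<in> U \<Longrightarrow> g (h u) = u"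
    using hg by (auto simp: homeomorphism_def)
  note rt = return_time_clopen[OF U(1,3)]
  \<comment> \<open>The inverse conjugacy \<open>g\<close> intertwines \<open>T\<close> with the
    induced map, which makes it an orbit morphism with the return time at \<open>g x\<close> as time
    function.\<close>
  have gT: "g (T x) = induced_map T U (g x)" if "x \<in> X" for x
  proof -
    have "g x \<in> U" using that g by blast
    then have "h (induced_map T U (g x)) = T x" "induced_map T U (g x) \<in> U"
      using conj g(3)[OF that] rt(3) U(2) by auto
    then show ?thesis using g(4) by metis
  qed
  let ?r = "\<lambda>x. return_time T U (g x)"
  have gX: "g x \<in> X" if "x \<in> X" for x
    using g(2) U(2) that by auto
  have om: "orbit_morphism g ?r"
    unfolding orbit_morphism_def
  proof (intro conjI ballI)
    show "continuous_on X ?r"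
      using rt(1) g(1) gX by (intro continuous_on_compose2[where f = g and g = "return_time T U"]) auto
  qed (use g(1) gX gT in \<open>auto simp: induced_map_def\<close>)
  have pos: "1 \<le> ?r x" if "x \<in> X" for x
    using rt(2) gX that by blast
  \<comment> \<open>If all these return times were 1, \<open>g\<close> would commute with
    \<open>T\<close>, and its image \<open>U\<close> would be a proper closed invariant set.\<close>
  have "\<exists>x\<in>X. ?r x \<noteq> 1"
  proof (rule ccontr)
    assume "\<not> (\<exists>x\<in>X. ?r x \<noteq> 1)"
    then have "T (g x) = g (T x)" if "x \<in> X" for x
      using om that by (simp add: orbit_morphism_def)
    then have "T ` (g ` X) = g ` (T ` X)"
      by (simp add: image_image cong: image_cong)
    also have "T ` X = X"
      using homeo by (simp add: homeomorphism_def)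
    finally have "T ` U = U"
      using g(2) by simp
    with invariant_closed_eq[of U] U show False
      by (auto simp: clopen_in_def)
  qed
  then obtain x0 where "x0 \<in> X" "?r x0 \<noteq> 1"
    by blast
  from orbit_morphism_doubling[OF om pos this] obtain \<psi> s
    where \<psi>: "orbit_morphism \<psi> s" "\<And>x. x \<in> X \<Longrightarrow> 2 \<le> s x"
    by blast
  obtain \<delta> where \<delta>: "\<delta> > 0"
    "\<And>x y. x \<in> X \<Longrightarrow> y \<in> X \<Longrightarrow> x \<noteq> y \<Longrightarrow> \<exists>n. \<delta> < dist (P n x) (P n y)"
    using assms(3) unfolding expansive_def by blast
  have "\<And>x. x \<in> X \<Longrightarrow> connected_component_set X x = {x}"
    using assms(1) unfolding minimal_cantor_system_def cantor_set_def by blast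
  \<comment> \<open>Points in one cell are closer than \<open>\<delta>\<close>, so expansiveness
    puts distinct points into different cells at some time; this makes \<open>c\<close>
    generating.\<close>
  from small_clopen_partition[OF compact this \<delta>(1)] obtain c :: "'a \<Rightarrow> nat"
    where c: "continuous_on X c" "\<And>x y. x \<in> X \<Longrightarrow> y \<in> X \<Longrightarrow> c x = c y \<Longrightarrow> dist x y < \<delta>"
    by blast
  have "generating c"
    unfolding generating_def
  proof (intro conjI ballI impI c(1))
    fix x y assume xy: "x \<in> X" "y \<in> X" and "\<forall>n. c (P n x) = c (P n y)"
    then have "dist (P n x) (P n y) < \<delta>" for n
      using c(2) P_in by blast
    then show "x = y"
      using \<delta>(2)[OF xy] by (meson order.asym)
  qed
  from substitutive_code[OF \<psi> this] obtain C where "generating C"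
    "\<And>x y. x \<in> X \<Longrightarrow> y \<in> X \<Longrightarrow> C x = C y \<Longrightarrow> itinerary T C (s x) (\<psi> x) = itinerary T C (s y) (\<psi> y)"
    by blast
  from substitution_conjugacy[OF \<psi> this] show ?thesis .
qed

end
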